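(* Let $A:L^1(\Omega)\to L^\infty(\Gamma)$, $f$, $f^\delta$, $R$, $H_{f^\delta}$, $u^\dagger$ and $u_\alpha^\delta$ ($\alpha,\delta>0$) be as in the context. Assume that $Au_\alpha^\delta\in E$ for any $\alpha,\delta>0$, and that there exists a positive constant $m$ with $m\le\inf\{\operatorname{ess\,inf}Au_\alpha^\delta:\alpha,\delta>0,\ \alpha,\delta\text{ sufficiently small}\}$. Assume moreover that there exist $p^\dagger\in L^\infty(\Gamma)$ with $A^*p^\dagger\in\partial R(u^\dagger)$ and a strictly increasing, continuous, concave function $\Phi:[0,+\infty)\to[0,+\infty)$ with $\Phi(0)=0$ such that $$\forall p\in L^\infty(\Gamma),\qquad\int_\Gamma f(t)p^\dagger(t)\,(p^\dagger(t)-p(t))\,dt\le\Phi\big(D_{R^*}(A^*p,A^*p^\dagger)\big).$$ Then, for all sufficiently small $\alpha,\delta>0$, $$D_R(u_\alpha^\delta,u^\dagger)\le\frac{\delta^2}{\alpha}\cdot\frac{\mu(\Gamma)}{\gamma}+2\Psi(\alpha)+\Phi^{-1}\left(\delta^2\frac{\Vert p^\dagger\Vert_2^2}{\gamma}+\alpha^2\delta^2\frac{\Vert(p^\dagger)^2\Vert_2^2}{\gamma}+\alpha^2\frac{\Vert f(p^\dagger)^2\Vert_2^2}{\gamma}\right),$$ where $\Psi$ is the convex conjugate of the convex mapping $t\mapsto\Phi^{-1}(t)$, $\mu(\Gamma)$ is the Lebesgue measure of $\Gamma$ and $\gamma=\frac{2m}{3}$.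
   Context: $\Omega,\Gamma\subset\mathbb{R}^2$ are bounded measurable sets. $A:L^1(\Omega)\to L^\infty(\Gamma)$ is linear, compact and ill-posed (i.e. the equation $Au=f$ is ill-posed). The exact data $f\in L^\infty(\Gamma)$ are not known; for each $\delta>0$ one has noisy data $f^\delta\in L^\infty(\Gamma)$, $f^\delta\ge0$, with $\Vert f-f^\delta\Vert_\infty\le\delta$, and there are constants $C_1,C_2>0$ independent of $\delta$ such that $C_1<f^\delta(t)<C_2$ for a.e. $t\in\Gamma$. The data fidelity is the Kullback-Leibler functional $H_{f^\delta}:L^\infty(\Gamma)\to[0,+\infty]$, $H_{f^\delta}(z)=\int_\Gamma\varphi_{f^\delta}(t,z(t))\,dt$ if $z\ge0$ a.e. and $z\ln z\in L^1(\Gamma)$, and $H_{f^\delta}(z)=+\infty$ otherwise, where $\varphi_{f^\delta}(t,\tau)=f^\delta(t)\ln\frac{f^\delta(t)}{\tau}-f^\delta(t)+\tau$ for $\tau>0$ and $\varphi_{f^\delta}(t,\tau)=+\infty$ for $\tau\le0$. $R:L^1(\Omega)\to\mathbb{R}\cup\{+\infty\}$ is proper, convex and lower semicontinuous, with Fenchel conjugate $R^*$. $u^\dagger\in\operatorname{arg\,min}\{R(u):Au=f\}$. For all $\alpha,\delta>0$ it is assumed that a minimizer $u_\alpha^\delta$ of $\frac1\alpha H_{f^\delta}(Au)+R(u)$ over $u\in L^1(\Omega)$ exists, and that there is $u_0\in\operatorname{dom}(H_{f^\delta}\circ A)\cap\operatorname{dom}R$ such that $H_{f^\delta}$ is continuous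 at $Au_0$. $E=\{v\in L^1(\Gamma):0<\operatorname{ess\,inf}v\le\operatorname{ess\,sup}v<+\infty\}$. An element $p\in L^\infty(\Gamma)$ is regarded as the element $z\mapsto\int_\Gamma pz\,dt$ of $(L^\infty(\Gamma))^*$. Products and powers of functions are pointwise; $\Vert\cdot\Vert_2$ is the $L^2(\Gamma)$-norm. Bregman distances: $D_R(u,u^\dagger)=R(u)-R(u^\dagger)-\langle A^*p^\dagger,u-u^\dagger\rangle$ and $D_{R^*}(A^*p,A^*p^\dagger)=R^*(A^*p)-R^*(A^*p^\dagger)-\langle u^\dagger,A^*p-A^*p^\dagger\rangle$ (note $u^\dagger\in\partial R^*(A^*p^\dagger)$). The right-hand side of the variational inequality is read as $+\infty$ when $D_{R^*}(A^*p,A^*p^\dagger)=+\infty$. $\Phi^{-1}$ is extended by $+\infty$ outside the range of $\Phi$, and $\Psi(\alpha)=\sup_{t\ge0}\{\alpha t-\Phi^{-1}(t)\}$. *)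

theory Defs
  imports "HOL-Analysis.Analysis" "HOL-Probability.Essential_Supremum"
begin

text \<open>Elements of Lebesgue spaces are represented by measurable functions. Operators and functionals
  act on representatives and are explicitly required to respect equality almost everywhere.\<close>

definition ae_eq :: "'a measure \<Rightarrow> ('a \<Rightarrow> real) \<Rightarrow> ('a \<Rightarrow> real) \<Rightarrow> bool" where
  "ae_eq M u v \<longleftrightarrow> (AE x in M. u x = v x)"

definition L1 :: "'a measure \<Rightarrow> ('a \<Rightarrow> real) set" where
  "L1 M = {u. integrable M u}"

definition L1_norm :: "'a measure \<Rightarrow> ('a \<Rightarrow> real) \<Rightarrow> real" where
  "L1_norm M u = (\<integral>x. \<bar>u x\<bar> \<partial>M)"

definition L2_norm :: "'a measure \<Rightarrow> ('a \<Rightarrow> real) \<Rightarrow> real" where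
  "L2_norm M u = sqrt (\<integral>x. (u x)\<^sup>2 \<partial>M)"

definition ess_sup :: "'a measure \<Rightarrow> ('a \<Rightarrow> real) \<Rightarrow> ereal" where
  "ess_sup M u = esssup M (\<lambda>x. ereal (u x))"

definition ess_inf :: "'a measure \<Rightarrow> ('a \<Rightarrow> real) \<Rightarrow> ereal" where
  "ess_inf M u = - ess_sup M (\<lambda>x. - u x)"

definition Linf :: "'a measure \<Rightarrow> ('a \<Rightarrow> real) set" where
  "Linf M = {z \<in> borel_measurable M. ess_sup M (\<lambda>x. \<bar>z x\<bar>) < \<infinity>}"

text \<open>On a null measure the essential supremum is \<open>-\<infinity>\<close>; the conversion to a real number then yields
  the correct value 0 of the norm.\<close>

definition Linf_norm :: "'a measure \<Rightarrow> ('a \<Rightarrow> real) \<Rightarrow> real" where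
  "Linf_norm M z = real_of_ereal (ess_sup M (\<lambda>x. \<bar>z x\<bar>))"

definition pos_bounded :: "'a measure \<Rightarrow> ('a \<Rightarrow> real) set" where
  "pos_bounded M = {v \<in> L1 M. 0 < ess_inf M v \<and> ess_inf M v \<le> ess_sup M v \<and> ess_sup M v < \<infinity>}"


text \<open>Operators from \<open>L\<^sup>1\<close> to \<open>L\<^sup>\<infinity>\<close>.\<close>

definition linear_L1_Linf ::
  "'a measure \<Rightarrow> 'b measure \<Rightarrow> (('a \<Rightarrow> real) \<Rightarrow> 'b \<Rightarrow> real) \<Rightarrow> bool" where
  "linear_L1_Linf M N A \<longleftrightarrow>
     (\<forall>u \<in> L1 M. A u \<in> Linf N) \<and>
     (\<forall>u \<in> L1 M. \<forall>v \<in> L1 M. ae_eq M u v \<longrightarrow> ae_eq N (A u) (A v)) \<and>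
     (\<forall>u \<in> L1 M. \<forall>v \<in> L1 M. ae_eq N (A (\<lambda>x. u x + v x)) (\<lambda>t. A u t + A v t)) \<and>
     (\<forall>c. \<forall>u \<in> L1 M. ae_eq N (A (\<lambda>x. c * u x)) (\<lambda>t. c * A u t))"

text \<open>Relative compactness of images of bounded sets, expressed by sequences.\<close>

definition compact_L1_Linf ::
  "'a measure \<Rightarrow> 'b measure \<Rightarrow> (('a \<Rightarrow> real) \<Rightarrow> 'b \<Rightarrow> real) \<Rightarrow> bool" where
  "compact_L1_Linf M N A \<longleftrightarrow>
     (\<forall>u :: nat \<Rightarrow> 'a \<Rightarrow> real. (\<forall>n. u n \<in> L1 M) \<and> (\<exists>B. \<forall>n. L1_norm M (u n) \<le> B) \<longrightarrow>
       (\<exists>r :: nat \<Rightarrow> nat. \<exists>z \<in> Linf N. strict_mono r \<and>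
         (\<lambda>n. Linf_norm N (\<lambda>t. A (u (r n)) t - z t)) \<longlonglongrightarrow> 0))"

text \<open>Well-posedness in the sense of Hadamard: for every right-hand side there is a solution, it is
  unique, and it depends continuously on the right-hand side.\<close>

definition well_posed ::
  "'a measure \<Rightarrow> 'b measure \<Rightarrow> (('a \<Rightarrow> real) \<Rightarrow> 'b \<Rightarrow> real) \<Rightarrow> bool" where
  "well_posed M N A \<longleftrightarrow>
     (\<forall>z \<in> Linf N. \<exists>u \<in> L1 M. ae_eq N (A u) z) \<and>
     (\<forall>u \<in> L1 M. \<forall>v \<in> L1 M. ae_eq N (A u) (A v) \<longrightarrow> ae_eq M u v) \<and>
     (\<forall>u \<in> L1 M. \<forall>\<epsilon>>0. \<exists>\<eta>>0. \<forall>v \<in> L1 M.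
        Linf_norm N (\<lambda>t. A v t - A u t) < \<eta> \<longrightarrow> L1_norm M (\<lambda>x. v x - u x) < \<epsilon>)"


text \<open>Extended-real functionals on \<open>L\<^sup>1\<close>.\<close>

definition functional_L1 :: "'a measure \<Rightarrow> (('a \<Rightarrow> real) \<Rightarrow> ereal) \<Rightarrow> bool" where
  "functional_L1 M R \<longleftrightarrow>
     (\<forall>u \<in> L1 M. R u \<noteq> -\<infinity>) \<and> (\<forall>u \<in> L1 M. \<forall>v \<in> L1 M. ae_eq M u v \<longrightarrow> R u = R v)"

definition proper_L1 :: "'a measure \<Rightarrow> (('a \<Rightarrow> real) \<Rightarrow> ereal) \<Rightarrow> bool" where
  "proper_L1 M R \<longleftrightarrow> (\<exists>u \<in> L1 M. R u < \<infinity>)"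

definition convex_L1 :: "'a measure \<Rightarrow> (('a \<Rightarrow> real) \<Rightarrow> ereal) \<Rightarrow> bool" where
  "convex_L1 M R \<longleftrightarrow>
     (\<forall>u \<in> L1 M. \<forall>v \<in> L1 M. \<forall>s \<in> {0..1}.
        R (\<lambda>x. (1 - s) * u x + s * v x) \<le> ereal (1 - s) * R u + ereal s * R v)"

definition lsc_L1 :: "'a measure \<Rightarrow> (('a \<Rightarrow> real) \<Rightarrow> ereal) \<Rightarrow> bool" where
  "lsc_L1 M R \<longleftrightarrow>
     (\<forall>u \<in> L1 M. \<forall>c < R u. \<exists>\<eta>>0. \<forall>v \<in> L1 M. L1_norm M (\<lambda>x. v x - u x) < \<eta> \<longrightarrow> c < R v)"

definition dual_L1 :: "'a measure \<Rightarrow> (('a \<Rightarrow> real) \<Rightarrow> real) set" where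
  "dual_L1 M = {\<xi>.
     (\<forall>u \<in> L1 M. \<forall>v \<in> L1 M. \<xi> (\<lambda>x. u x + v x) = \<xi> u + \<xi> v) \<and>
     (\<forall>c. \<forall>u \<in> L1 M. \<xi> (\<lambda>x. c * u x) = c * \<xi> u) \<and>
     (\<exists>C. \<forall>u \<in> L1 M. \<bar>\<xi> u\<bar> \<le> C * L1_norm M u)}"

definition subdifferential_L1 ::
  "'a measure \<Rightarrow> (('a \<Rightarrow> real) \<Rightarrow> ereal) \<Rightarrow> ('a \<Rightarrow> real) \<Rightarrow> (('a \<Rightarrow> real) \<Rightarrow> real) set" where
  "subdifferential_L1 M R u = {\<xi> \<in> dual_L1 M. R u < \<infinity> \<and>
     (\<forall>v \<in> L1 M. R u + ereal (\<xi> (\<lambda>x. v x - u x)) \<le> R v)}"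

definition fenchel_conj_L1 ::
  "'a measure \<Rightarrow> (('a \<Rightarrow> real) \<Rightarrow> ereal) \<Rightarrow> (('a \<Rightarrow> real) \<Rightarrow> real) \<Rightarrow> ereal" where
  "fenchel_conj_L1 M R \<xi> = (SUP u \<in> L1 M. ereal (\<xi> u) - R u)"

definition pairing :: "'b measure \<Rightarrow> ('b \<Rightarrow> real) \<Rightarrow> ('b \<Rightarrow> real) \<Rightarrow> real" where
  "pairing N p = (\<lambda>z. \<integral>t. p t * z t \<partial>N)"

definition adjoint_op ::
  "(('a \<Rightarrow> real) \<Rightarrow> 'b \<Rightarrow> real) \<Rightarrow> (('b \<Rightarrow> real) \<Rightarrow> real) \<Rightarrow> ('a \<Rightarrow> real) \<Rightarrow> real" where
  "adjoint_op A P = (\<lambda>u. P (A u))"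

definition bregman ::
  "(('a \<Rightarrow> real) \<Rightarrow> ereal) \<Rightarrow> (('a \<Rightarrow> real) \<Rightarrow> real) \<Rightarrow> ('a \<Rightarrow> real) \<Rightarrow> ('a \<Rightarrow> real) \<Rightarrow> ereal" where
  "bregman R \<xi> u v = R u - R v - ereal (\<xi> (\<lambda>x. u x - v x))"

text \<open>The Bregman distance of a functional on the dual space, where the subgradient is an element
  \<open>w\<close> of \<open>L\<^sup>1\<close>, acting on dual elements by evaluation.\<close>

definition bregman_dual ::
  "((('a \<Rightarrow> real) \<Rightarrow> real) \<Rightarrow> ereal) \<Rightarrow> ('a \<Rightarrow> real) \<Rightarrow>
   (('a \<Rightarrow> real) \<Rightarrow> real) \<Rightarrow> (('a \<Rightarrow> real) \<Rightarrow> real) \<Rightarrow> ereal" where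
  "bregman_dual F w \<xi> \<zeta> = F \<xi> - F \<zeta> - ereal (\<xi> w - \<zeta> w)"


text \<open>The Kullback-Leibler functional. For \<open>g \<ge> 0\<close> the integrand is nonnegative, so that the
  nonnegative integral is the integral meant; \<open>0 * ln 0 = 0\<close> agrees with the usual convention.\<close>

definition KL_integrand :: "real \<Rightarrow> real \<Rightarrow> ereal" where
  "KL_integrand y \<tau> = (if \<tau> > 0 then ereal (y * ln (y / \<tau>) - y + \<tau>) else \<infinity>)"

definition KL :: "'b measure \<Rightarrow> ('b \<Rightarrow> real) \<Rightarrow> ('b \<Rightarrow> real) \<Rightarrow> ereal" where
  "KL N g z =
     (if (AE t in N. 0 \<le> z t) \<and> integrable N (\<lambda>t. z t * ln (z t))
      then enn2ereal (\<integral>\<^sup>+ t. e2ennreal (KL_integrand (g t) (z t)) \<partial>N)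
      else \<infinity>)"

definition continuous_at_Linf ::
  "'b measure \<Rightarrow> (('b \<Rightarrow> real) \<Rightarrow> ereal) \<Rightarrow> ('b \<Rightarrow> real) \<Rightarrow> bool" where
  "continuous_at_Linf N H z \<longleftrightarrow>
     (\<forall>V. open V \<and> H z \<in> V \<longrightarrow>
       (\<exists>\<eta>>0. \<forall>z' \<in> Linf N. Linf_norm N (\<lambda>t. z' t - z t) < \<eta> \<longrightarrow> H z' \<in> V))"


text \<open>Index functions \<open>[0,\<infinity>) \<rightarrow> [0,\<infinity>)\<close>, extended by \<open>+\<infinity>\<close> at \<open>+\<infinity>\<close>; their inverses, extended by \<open>+\<infinity>\<close>
  outside the range; and the convex conjugates of the latter.\<close>

definition ext_infty :: "(real \<Rightarrow> real) \<Rightarrow> ereal \<Rightarrow> ereal" where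
  "ext_infty \<Phi> x = (if x = \<infinity> then \<infinity> else ereal (\<Phi> (real_of_ereal x)))"

definition inverse_ext :: "(real \<Rightarrow> real) \<Rightarrow> real \<Rightarrow> ereal" where
  "inverse_ext \<Phi> t = (if t \<in> \<Phi> ` {0..} then ereal (inv_into {0..} \<Phi> t) else \<infinity>)"

definition inverse_conj :: "(real \<Rightarrow> real) \<Rightarrow> real \<Rightarrow> ereal" where
  "inverse_conj \<Phi> \<alpha> = (SUP t \<in> {0..}. ereal (\<alpha> * t) - inverse_ext \<Phi> t)"

end

theory Submission
  imports Defs
begin

text \<open>Write \<open>z = A u\<close> for a minimizer \<open>u\<close>, \<open>g\<close> for the noisy data and \<open>q\<close> for the certificate at the exact
  solution \<open>w\<close>. Since \<open>z \<ge> m > 0\<close>, the fidelity has the gradient \<open>1 - g / z\<close> at \<open>z\<close>, and first-order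
  optimality says that \<open>p = (g - z) / (\<alpha> z)\<close> is a certificate at \<open>u\<close>: \<open>A\<^sup>* p\<close> is a subgradient of \<open>R\<close> there
  (\<open>minimizer_subgradient\<close>). Let \<open>D\<close> be the Bregman distance to be estimated and \<open>D'\<close> the distance of
  \<open>A\<^sup>* p\<close> and \<open>A\<^sup>* q\<close> with respect to the conjugate of \<open>R\<close>. Equality in the Fenchel-Young
  inequality gives \<open>D + D' = \<integral> (p - q) (z - f)\<close> (\<open>bregman_sum_identity\<close>).

  The relation \<open>z (1 + \<alpha> p) = g\<close> allows the integrand to be bounded pointwise by
  \<open>\<alpha> f q (q - p)\<close> plus a remainder that no longer contains \<open>p\<close>: after multiplication by \<open>1 + \<alpha> q\<close>,
  which is close to 1 for small \<open>\<alpha>\<close>, the rest is a concave quadratic in \<open>q - p\<close>, and one maximizes it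
  (\<open>source_term_pointwise_le\<close>). The variational inequality bounds the integral of \<open>f q (q - p)\<close> by
  \<open>\<Phi>(D')\<close>, and Young's inequality \<open>\<alpha> \<Phi>(D') \<le> \<Psi>(\<alpha>) + D'\<close> lets \<open>D'\<close> cancel. What is left for \<open>D\<close> is
  \<open>\<Psi>(\<alpha>)\<close>, the term of order \<open>\<delta>\<^sup>2 / \<alpha>\<close>, and \<open>\<alpha> s\<close> with \<open>s = \<alpha>\<^sup>2 \<parallel>f q\<^sup>2\<parallel>\<^sup>2 / \<gamma>\<close>; a second use of Young's
  inequality replaces \<open>\<alpha> s\<close> by \<open>\<Psi>(\<alpha>) + \<Phi>\<inverse>(s)\<close> (\<open>bregman_rate\<close>). Monotonicity of \<open>\<Phi>\<inverse>\<close> then gives the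
  stated bound.\<close>


section \<open>Bounded functions up to null sets\<close>

lemma Linf_iff_AE_bounded:
  "z \<in> Linf N \<longleftrightarrow> z \<in> borel_measurable N \<and> (\<exists>B\<ge>0. AE t in N. \<bar>z t\<bar> \<le> B)"
proof
  assume z: "z \<in> Linf N"
  hence [measurable]: "z \<in> borel_measurable N" and fin: "ess_sup N (\<lambda>t. \<bar>z t\<bar>) < \<infinity>"
    by (auto simp: Linf_def)
  obtain r :: real where r: "ess_sup N (\<lambda>t. \<bar>z t\<bar>) \<le> ereal r"
    using fin by (cases "ess_sup N (\<lambda>t. \<bar>z t\<bar>)") auto
  have "AE t in N. ereal \<bar>z t\<bar> \<le> ess_sup N (\<lambda>t. \<bar>z t\<bar>)"
    unfolding ess_sup_def by (rule esssup_AE)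
  hence "AE t in N. \<bar>z t\<bar> \<le> max r 0"
  proof eventually_elim
    case (elim t)
    have "ereal \<bar>z t\<bar> \<le> ereal r" using elim r by (rule order_trans)
    thus ?case by simp
  qed
  thus "z \<in> borel_measurable N \<and> (\<exists>B\<ge>0. AE t in N. \<bar>z t\<bar> \<le> B)"
    by (intro conjI exI[of _ "max r 0"]) auto
next
  assume "z \<in> borel_measurable N \<and> (\<exists>B\<ge>0. AE t in N. \<bar>z t\<bar> \<le> B)"
  then obtain B where [measurable]: "z \<in> borel_measurable N" and B: "AE t in N. \<bar>z t\<bar> \<le> B" by auto
  have "ess_sup N (\<lambda>t. \<bar>z t\<bar>) \<le> ereal B"
    unfolding ess_sup_def using B by (intro esssup_I) auto
  thus "z \<in> Linf N" by (auto simp: Linf_def intro: le_less_trans)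
qed

lemma Linf_measurable: "z \<in> Linf N \<Longrightarrow> z \<in> borel_measurable N"
  by (simp add: Linf_def)

lemma Linf_bound: "z \<in> Linf N \<Longrightarrow> \<exists>B\<ge>0. AE t in N. \<bar>z t\<bar> \<le> B"
  by (simp add: Linf_iff_AE_bounded)

lemma LinfI: "z \<in> borel_measurable N \<Longrightarrow> AE t in N. \<bar>z t\<bar> \<le> B \<Longrightarrow> z \<in> Linf N"
  unfolding Linf_iff_AE_bounded
  by (intro conjI exI[of _ "max B 0"]) (auto elim: eventually_mono)

lemma Linf_const: "(\<lambda>_. c) \<in> Linf N"
  by (rule LinfI[of _ _ "\<bar>c\<bar>"]) auto

lemma Linf_add:
  assumes "y \<in> Linf N" "z \<in> Linf N" shows "(\<lambda>t. y t + z t) \<in> Linf N"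
proof -
  have [measurable]: "y \<in> borel_measurable N" "z \<in> borel_measurable N"
    using assms by (auto simp: Linf_measurable)
  obtain B where "AE t in N. \<bar>y t\<bar> \<le> B" using Linf_bound[OF assms(1)] by auto
  moreover obtain C where "AE t in N. \<bar>z t\<bar> \<le> C" using Linf_bound[OF assms(2)] by auto
  ultimately have "AE t in N. \<bar>y t + z t\<bar> \<le> B + C" by eventually_elim linarith
  thus ?thesis by (intro LinfI) auto
qed

lemma Linf_mult:
  assumes "y \<in> Linf N" "z \<in> Linf N" shows "(\<lambda>t. y t * z t) \<in> Linf N"
proof -
  have [measurable]: "y \<in> borel_measurable N" "z \<in> borel_measurable N"
    using assms by (auto simp: Linf_measurable)
  obtain B where B: "0 \<le> B" "AE t in N. \<bar>y t\<bar> \<le> B" using Linf_bound[OF assms(1)] by auto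
  obtain C where C: "AE t in N. \<bar>z t\<bar> \<le> C" using Linf_bound[OF assms(2)] by auto
  have "AE t in N. \<bar>y t * z t\<bar> \<le> B * C"
    using B(2) C by eventually_elim (use B(1) in \<open>auto simp: abs_mult intro: mult_mono\<close>)
  thus ?thesis by (intro LinfI) auto
qed

lemma Linf_diff: "y \<in> Linf N \<Longrightarrow> z \<in> Linf N \<Longrightarrow> (\<lambda>t. y t - z t) \<in> Linf N"
  using Linf_add[of y N "\<lambda>t. -1 * z t"] Linf_mult[OF Linf_const[of "-1" N], of z] by simp

lemma Linf_power: "z \<in> Linf N \<Longrightarrow> (\<lambda>t. z t ^ n) \<in> Linf N"
  by (induction n) (simp_all, intro Linf_const, intro Linf_mult)

lemma Linf_divide:
  assumes "y \<in> Linf N" "z \<in> borel_measurable N" "0 < c" "AE t in N. c \<le> z t"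
  shows "(\<lambda>t. y t / z t) \<in> Linf N"
proof -
  have "AE t in N. \<bar>1 / z t\<bar> \<le> 1 / c"
    using assms(4) by eventually_elim (use assms(3) in \<open>auto simp: frac_le\<close>)
  hence "(\<lambda>t. 1 / z t) \<in> Linf N" using assms(2) by (intro LinfI) auto
  thus ?thesis using Linf_mult[OF assms(1), of "\<lambda>t. 1 / z t"] by simp
qed

lemmas Linf_intros = Linf_const Linf_add Linf_diff Linf_mult Linf_power

lemma (in finite_measure) Linf_integrable:
  assumes "z \<in> Linf M" shows "integrable M z"
proof -
  obtain B where "AE t in M. \<bar>z t\<bar> \<le> B" using Linf_bound[OF assms] by auto
  thus ?thesis
    using Linf_measurable[OF assms] by (intro integrable_const_bound[of z B]) auto
qed

lemma AE_le_Linf_norm: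
  assumes "z \<in> Linf N" shows "AE t in N. \<bar>z t\<bar> \<le> Linf_norm N z"
proof -
  have "AE t in N. ereal \<bar>z t\<bar> \<le> ess_sup N (\<lambda>t. \<bar>z t\<bar>)"
    unfolding ess_sup_def by (rule esssup_AE)
  thus ?thesis
  proof eventually_elim
    case (elim t)
    thus ?case using assms
      by (cases "ess_sup N (\<lambda>t. \<bar>z t\<bar>)") (auto simp: Linf_norm_def Linf_def)
  qed
qed

lemma AE_ge_of_ess_inf_ge:
  assumes "ereal m \<le> ess_inf N z" shows "AE t in N. m \<le> z t"
proof -
  have "AE t in N. ereal (- z t) \<le> ess_sup N (\<lambda>t. - z t)"
    unfolding ess_sup_def by (rule esssup_AE)
  thus ?thesis
  proof eventually_elim
    case (elim t)
    have "ess_sup N (\<lambda>t. - z t) \<le> ereal (- m)"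
      using assms unfolding ess_inf_def by (cases "ess_sup N (\<lambda>t. - z t)") auto
    with elim have "ereal (- z t) \<le> ereal (- m)" by (rule order_trans)
    thus ?case by simp
  qed
qed


section \<open>The Kullback-Leibler functional along a line\<close>

definition kl_density :: "real \<Rightarrow> real \<Rightarrow> real" where
  "kl_density y \<tau> = y * ln (y / \<tau>) - y + \<tau>"

lemma kl_density_bounds:
  assumes "0 < y" "0 < \<tau>"
  shows "0 \<le> kl_density y \<tau>" "kl_density y \<tau> \<le> y\<^sup>2 / \<tau> + \<tau>"
proof -
  have "ln (\<tau> / y) \<le> \<tau> / y - 1" using assms by (intro ln_le_minus_one) auto
  hence "y * ln (\<tau> / y) \<le> y * (\<tau> / y - 1)" using assms by simp
  also have "\<dots> = \<tau> - y" using assms by (simp add: field_simps)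
  finally show "0 \<le> kl_density y \<tau>" using assms by (simp add: kl_density_def ln_div algebra_simps)
  have "ln (y / \<tau>) \<le> y / \<tau> - 1" using assms by (intro ln_le_minus_one) auto
  hence "y * ln (y / \<tau>) \<le> y * (y / \<tau> - 1)" using assms by simp
  also have "\<dots> = y\<^sup>2 / \<tau> - y" by (simp add: power2_eq_square algebra_simps)
  finally show "kl_density y \<tau> \<le> y\<^sup>2 / \<tau> + \<tau>" using assms by (simp add: kl_density_def)
qed

text \<open>Where the argument is bounded away from zero, the density has the second derivative
  \<open>y / \<tau>\<^sup>2\<close>, so a first-order expansion holds with a quadratic remainder that is uniform over the
  domain and can be integrated.\<close>

lemma kl_density_line_le:
  assumes "0 < y" "y \<le> C" "0 < c" "c \<le> \<tau>" "\<bar>h\<bar> \<le> B" "0 \<le> s" "s * B \<le> c / 2"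
  shows "kl_density y (\<tau> + s * h)
          \<le> kl_density y \<tau> + s * ((1 - y / \<tau>) * h) + s\<^sup>2 * (2 * C * (B / c)\<^sup>2)"
proof -
  define x where "x = s * h / \<tau>"
  have tau: "0 < \<tau>" using assms by simp
  have x_le: "\<bar>x\<bar> \<le> s * B / c"
    unfolding x_def using assms tau
    by (auto simp: abs_mult intro!: frac_le mult_left_mono mult_nonneg_nonneg)
  also have "\<dots> \<le> 1 / 2" using assms by (simp add: field_simps)
  finally have x_half: "\<bar>x\<bar> \<le> 1 / 2" .
  hence one_plus: "0 < 1 + x" by linarith
  have "\<bar>ln (1 + x) - x\<bar> \<le> 2 * x\<^sup>2" using x_half by (rule abs_ln_one_plus_x_minus_x_bound)
  hence ln_ge: "x - ln (1 + x) \<le> 2 * x\<^sup>2" by linarith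
  have "x\<^sup>2 \<le> (s * B / c)\<^sup>2" using power_mono[OF x_le, of 2] by simp
  hence "2 * x\<^sup>2 \<le> 2 * (s * B / c)\<^sup>2" by simp
  with ln_ge have "x - ln (1 + x) \<le> 2 * (s * B / c)\<^sup>2" by linarith
  hence "y * (x - ln (1 + x)) \<le> C * (2 * (s * B / c)\<^sup>2)"
    using assms by (intro order_trans[OF mult_left_mono mult_right_mono]) auto
  hence rem: "y * x - y * ln (1 + x) \<le> s\<^sup>2 * (2 * C * (B / c)\<^sup>2)"
    by (simp add: algebra_simps power_mult_distrib power_divide)
  have shift: "\<tau> + s * h = \<tau> * (1 + x)" using tau by (simp add: x_def field_simps)
  have "ln (y / (\<tau> + s * h)) = ln (y / \<tau>) - ln (1 + x)"
    unfolding shift using assms tau one_plus by (simp add: ln_div ln_mult)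
  hence "kl_density y (\<tau> + s * h) = kl_density y \<tau> - y * ln (1 + x) + s * h"
    by (simp add: kl_density_def right_diff_distrib)
  moreover have "s * ((1 - y / \<tau>) * h) = s * h - y * x"
    by (simp add: x_def algebra_simps)
  ultimately show ?thesis using rem by linarith
qed

lemma
  assumes "finite_measure N" "g \<in> Linf N" "z \<in> Linf N"
    and g: "AE t in N. 0 < g t" and c: "0 < c" "AE t in N. c \<le> z t"
  shows Linf_kl_density: "(\<lambda>t. kl_density (g t) (z t)) \<in> Linf N"
    and KL_eq_integral: "KL N g z = ereal (\<integral>t. kl_density (g t) (z t) \<partial>N)"
proof -
  interpret finite_measure N by fact
  have [measurable]: "g \<in> borel_measurable N" "z \<in> borel_measurable N"
    using assms by (auto simp: Linf_measurable)
  obtain B where B: "0 \<le> B" "AE t in N. \<bar>z t\<bar> \<le> B" using Linf_bound[OF assms(3)] by auto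
  obtain G where G: "0 \<le> G" "AE t in N. \<bar>g t\<bar> \<le> G" using Linf_bound[OF assms(2)] by auto
  have "AE t in N. \<bar>kl_density (g t) (z t)\<bar> \<le> G\<^sup>2 / c + B"
    using g c(2) B(2) G(2)
  proof eventually_elim
    case (elim t)
    have "(g t)\<^sup>2 / z t \<le> G\<^sup>2 / c"
      using elim c(1) by (intro frac_le power_mono) auto
    thus ?case using kl_density_bounds[of "g t" "z t"] elim c(1) by auto
  qed
  thus linf: "(\<lambda>t. kl_density (g t) (z t)) \<in> Linf N"
    unfolding kl_density_def by (intro LinfI) measurable
  have nonneg: "AE t in N. 0 \<le> kl_density (g t) (z t)"
    using g c(2) by eventually_elim (use c(1) in \<open>auto intro: kl_density_bounds\<close>)
  have "AE t in N. \<bar>z t * ln (z t)\<bar> \<le> 1 + B\<^sup>2"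
    using c(2) B(2)
  proof eventually_elim
    case (elim t)
    hence pos: "0 < z t" using c(1) by simp
    have "z t * ln (z t) \<le> z t * z t"
      using pos ln_le_minus_one[of "z t"] by (intro mult_left_mono) auto
    also have "\<dots> \<le> B * B" using elim pos B(1) by (intro mult_mono) auto
    finally have upper: "z t * ln (z t) \<le> B\<^sup>2" by (simp add: power2_eq_square)
    have "ln (1 / z t) \<le> 1 / z t - 1" using pos by (intro ln_le_minus_one) auto
    hence "z t * ln (1 / z t) \<le> z t * (1 / z t - 1)" using pos by simp
    also have "\<dots> = 1 - z t" using pos by (simp add: field_simps)
    finally have "- (z t * ln (z t)) \<le> 1" using pos by (simp add: ln_div)
    moreover have "0 \<le> B\<^sup>2" by simp
    ultimately show ?case using upper unfolding abs_le_iff by linarith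
  qed
  hence "integrable N (\<lambda>t. z t * ln (z t))"
    by (intro integrable_const_bound[where B = "1 + B\<^sup>2"]) auto
  moreover have "AE t in N. 0 \<le> z t" using c(2) by eventually_elim (use c(1) in auto)
  ultimately have "KL N g z = enn2ereal (\<integral>\<^sup>+ t. e2ennreal (KL_integrand (g t) (z t)) \<partial>N)"
    by (simp add: KL_def)
  also have "(\<integral>\<^sup>+ t. e2ennreal (KL_integrand (g t) (z t)) \<partial>N)
      = (\<integral>\<^sup>+ t. ennreal (kl_density (g t) (z t)) \<partial>N)"
    using c(2)
    by (intro nn_integral_cong_AE, eventually_elim)
       (use c(1) in \<open>auto simp: KL_integrand_def kl_density_def\<close>)
  also have "\<dots> = ennreal (\<integral>t. kl_density (g t) (z t) \<partial>N)"
    using Linf_integrable[OF linf] nonneg by (rule nn_integral_eq_integral)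
  finally show "KL N g z = ereal (\<integral>t. kl_density (g t) (z t) \<partial>N)"
    using integral_nonneg_AE[OF nonneg] by simp
qed

lemma KL_nonneg: "0 \<le> KL N g z"
  by (simp add: KL_def)


section \<open>Optimality of minimizers\<close>

lemma L1_lincomb: "u \<in> L1 M \<Longrightarrow> v \<in> L1 M \<Longrightarrow> (\<lambda>x. a * u x + b * v x) \<in> L1 M"
  by (simp add: L1_def)

lemma linear_op_lincomb_AE:
  assumes "linear_L1_Linf M N A" "u \<in> L1 M" "v \<in> L1 M"
  shows "AE t in N. A (\<lambda>x. a * u x + b * v x) t = a * A u t + b * A v t"
proof -
  have scaled: "(\<lambda>x. a * u x) \<in> L1 M" "(\<lambda>x. b * v x) \<in> L1 M"
    using assms(2,3) by (auto simp: L1_def)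
  have "AE t in N. A (\<lambda>x. a * u x + b * v x) t = A (\<lambda>x. a * u x) t + A (\<lambda>x. b * v x) t"
    using assms(1) scaled by (simp add: linear_L1_Linf_def ae_eq_def)
  moreover have "AE t in N. A (\<lambda>x. a * u x) t = a * A u t" "AE t in N. A (\<lambda>x. b * v x) t = b * A v t"
    using assms by (simp_all add: linear_L1_Linf_def ae_eq_def)
  ultimately show ?thesis by eventually_elim simp
qed

lemma linear_op_diff_AE:
  assumes "linear_L1_Linf M N A" "u \<in> L1 M" "v \<in> L1 M"
  shows "AE t in N. A (\<lambda>x. u x - v x) t = A u t - A v t"
  using linear_op_lincomb_AE[OF assms, of 1 "-1"] by simp

lemma linear_op_Linf: "linear_L1_Linf M N A \<Longrightarrow> u \<in> L1 M \<Longrightarrow> A u \<in> Linf N"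
  by (simp add: linear_L1_Linf_def)

lemma nonneg_if_small_steps:
  fixes a K :: real
  assumes "0 < s0" "\<And>s. 0 < s \<Longrightarrow> s \<le> s0 \<Longrightarrow> 0 \<le> s * a + s\<^sup>2 * K"
  shows "0 \<le> a"
proof (rule tendsto_lowerbound)
  show "((\<lambda>s. a + s * K) \<longlongrightarrow> a) (at_right 0)" by (auto intro!: tendsto_eq_intros)
  show "\<forall>\<^sub>F s in at_right 0. 0 \<le> a + s * K"
    unfolding eventually_at_right_field
  proof (intro exI[of _ s0] conjI allI impI)
    fix s assume s: "0 < s" "s < s0"
    hence "0 \<le> s * (a + s * K)"
      using assms(2)[of s] by (simp add: power2_eq_square algebra_simps)
    thus "0 \<le> a + s * K" using s by (simp add: zero_le_mult_iff)
  qed (use assms(1) in auto)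
qed simp

text \<open>Since \<open>A u\<close> stays away from zero, the fidelity is differentiable along segments at the
  minimizer, with gradient \<open>1 - g / A u\<close>. Moving from \<open>u\<close> towards \<open>v\<close> by a step \<open>s\<close> changes \<open>R\<close> by at
  most \<open>s (R v - R u)\<close> by convexity and the fidelity by its linear part up to \<open>O(s\<^sup>2)\<close>; minimality
  forces the sum of the linear parts to be nonnegative. This gives the subgradient explicitly,
  without a sum rule for subdifferentials.\<close>

lemma minimizer_subgradient:
  fixes A :: "('a \<Rightarrow> real) \<Rightarrow> 'b \<Rightarrow> real"
  assumes "finite_measure N" "linear_L1_Linf M N A" "functional_L1 M R" "convex_L1 M R"
    and "0 < \<alpha>" "g \<in> Linf N" "AE t in N. 0 < g t"
    and min: "is_arg_min (\<lambda>v. ereal (1 / \<alpha>) * KL N g (A v) + R v) (\<lambda>v. v \<in> L1 M) u"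
    and "R u < \<infinity>" "0 < c" "AE t in N. c \<le> A u t" "v \<in> L1 M"
  shows "R u + ereal (\<integral>t. (g t - A u t) / (\<alpha> * A u t) * (A v t - A u t) \<partial>N) \<le> R v"
proof (cases "R v = \<infinity>")
  case False
  interpret finite_measure N by fact
  have u: "u \<in> L1 M" using min by (simp add: is_arg_min_def)
  have v: "v \<in> L1 M" by fact
  obtain ru where ru: "R u = ereal ru"
    using \<open>R u < \<infinity>\<close> \<open>functional_L1 M R\<close> u unfolding functional_L1_def by (cases "R u") auto
  obtain rv where rv: "R v = ereal rv"
    using False \<open>functional_L1 M R\<close> v unfolding functional_L1_def by (cases "R v") auto
  note A_Linf = linear_op_Linf[OF assms(2)]
  define z where "z = A u"
  define h where "h = (\<lambda>t. A v t - A u t)"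
  have [measurable]: "g \<in> borel_measurable N" "A u \<in> borel_measurable N" "A v \<in> borel_measurable N"
    using assms(6) A_Linf u v by (auto intro!: Linf_measurable)
  have z: "z \<in> Linf N" "AE t in N. c \<le> z t"
    using assms(11) A_Linf[OF u] by (auto simp: z_def)
  have h: "h \<in> Linf N"
    unfolding h_def by (intro Linf_diff A_Linf u v)
  obtain B where B: "0 \<le> B" "AE t in N. \<bar>h t\<bar> \<le> B" using Linf_bound[OF h] by auto
  obtain C where C: "0 \<le> C" "AE t in N. \<bar>g t\<bar> \<le> C" using Linf_bound[OF assms(6)] by auto
  define G where "G = (\<integral>t. (1 - g t / z t) * h t \<partial>N)"
  define K where "K = 2 * C * (B / c)\<^sup>2"
  have [measurable]: "z \<in> borel_measurable N" using z(1) by (rule Linf_measurable)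
  have gz: "(\<lambda>t. g t / z t) \<in> Linf N"
    using assms z by (intro Linf_divide[of _ _ _ c]) auto
  have grad: "(\<lambda>t. (1 - g t / z t) * h t) \<in> Linf N"
    using gz h by (intro Linf_intros)
  have dens: "(\<lambda>t. kl_density (g t) (z t)) \<in> Linf N"
    using assms z by (intro Linf_kl_density)

  \<comment> \<open>The step bound 1 keeps \<open>us\<close> below on the segment from \<open>u\<close> to \<open>v\<close>, the other one keeps its image above
    \<open>c / 2\<close>; \<open>B + 1\<close> instead of \<open>B\<close> covers the case \<open>B = 0\<close>.\<close>
  have step: "0 \<le> s * (G / \<alpha> + (rv - ru)) + s\<^sup>2 * (K * measure N (space N) / \<alpha>)"
    if s: "0 < s" "s \<le> min 1 (c / (2 * (B + 1)))" for s
  proof -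
    define us where "us = (\<lambda>x. (1 - s) * u x + s * v x)"
    have us: "us \<in> L1 M" unfolding us_def using u v by (rule L1_lincomb)
    have "s * B \<le> s * (B + 1)" using s by simp
    also have "\<dots> \<le> c / (2 * (B + 1)) * (B + 1)" using s B by (intro mult_right_mono) auto
    also have "\<dots> = c / 2" using B by (simp add: field_simps)
    finally have sB: "s * B \<le> c / 2" .
    have Aus: "AE t in N. A us t = z t + s * h t"
      using linear_op_lincomb_AE[OF assms(2) u v, of "1 - s" s]
      by eventually_elim (simp add: us_def z_def h_def algebra_simps)
    have Aus_ge: "AE t in N. c / 2 \<le> A us t"
      using Aus z(2) B(2)
    proof eventually_elim
      case (elim t)
      have "s * \<bar>h t\<bar> \<le> s * B" using elim s by simp
      hence "s * \<bar>h t\<bar> \<le> c / 2" using sB by linarith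
      hence "\<bar>s * h t\<bar> \<le> c / 2" using s by (simp add: abs_mult)
      thus ?case using elim by (simp add: abs_le_iff)
    qed
    have Aus_Linf: "A us \<in> Linf N" using us by (rule A_Linf)
    have dens_s: "(\<lambda>t. kl_density (g t) (A us t)) \<in> Linf N"
      using assms Aus_Linf Aus_ge by (intro Linf_kl_density[of _ _ _ "c / 2"]) auto
    have KL_z: "KL N g (A u) = ereal (\<integral>t. kl_density (g t) (z t) \<partial>N)"
      unfolding z_def[symmetric] using assms z by (intro KL_eq_integral)
    have KL_s: "KL N g (A us) = ereal (\<integral>t. kl_density (g t) (A us t) \<partial>N)"
      using assms Aus_Linf Aus_ge by (intro KL_eq_integral[of _ _ _ "c / 2"]) auto
    have "(\<integral>t. kl_density (g t) (A us t) \<partial>N)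
        \<le> (\<integral>t. kl_density (g t) (z t) + s * ((1 - g t / z t) * h t) + s\<^sup>2 * K \<partial>N)"
    proof (rule integral_mono_AE)
      show "AE t in N. kl_density (g t) (A us t)
          \<le> kl_density (g t) (z t) + s * ((1 - g t / z t) * h t) + s\<^sup>2 * K"
        using Aus z(2) B(2) C(2) \<open>AE t in N. 0 < g t\<close>
      proof eventually_elim
        case (elim t)
        show ?case unfolding elim(1) K_def
          using elim s sB \<open>0 < c\<close> by (intro kl_density_line_le) auto
      qed
      show "integrable N (\<lambda>t. kl_density (g t) (z t) + s * ((1 - g t / z t) * h t) + s\<^sup>2 * K)"
        by (intro Linf_integrable Linf_intros dens gz h)
    qed (rule Linf_integrable[OF dens_s])
    also have "\<dots> = (\<integral>t. kl_density (g t) (z t) \<partial>N) + s * G + s\<^sup>2 * K * measure N (space N)"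
      using Linf_integrable[OF dens] Linf_integrable[OF grad] by (simp add: G_def)
    finally have KL_le: "(\<integral>t. kl_density (g t) (A us t) \<partial>N)
        \<le> (\<integral>t. kl_density (g t) (z t) \<partial>N) + s * G + s\<^sup>2 * K * measure N (space N)" .
    have "R us \<le> ereal (1 - s) * R u + ereal s * R v"
      using \<open>convex_L1 M R\<close> u v s unfolding convex_L1_def us_def by auto
    hence R_us: "R us \<le> ereal ((1 - s) * ru + s * rv)" by (simp add: ru rv)
    then obtain rs where rs: "R us = ereal rs"
      using \<open>functional_L1 M R\<close> us unfolding functional_L1_def by (cases "R us") auto
    have "ereal (1 / \<alpha>) * KL N g (A u) + R u \<le> ereal (1 / \<alpha>) * KL N g (A us) + R us"
      using min us unfolding is_arg_min_def by (auto simp: not_less)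
    hence "(\<integral>t. kl_density (g t) (z t) \<partial>N) / \<alpha> + ru
        \<le> (\<integral>t. kl_density (g t) (A us t) \<partial>N) / \<alpha> + rs"
      by (simp add: KL_z KL_s ru rs)
    also have "\<dots> \<le> ((\<integral>t. kl_density (g t) (z t) \<partial>N) + s * G + s\<^sup>2 * K * measure N (space N)) / \<alpha>
        + ((1 - s) * ru + s * rv)"
      using KL_le R_us \<open>0 < \<alpha>\<close> by (intro add_mono divide_right_mono) (auto simp: rs)
    finally show ?thesis by (simp add: algebra_simps add_divide_distrib)
  qed
  have "0 \<le> G / \<alpha> + (rv - ru)"
    by (rule nonneg_if_small_steps[of "min 1 (c / (2 * (B + 1)))", OF _ step]) (use B(1) \<open>0 < c\<close> in auto)
  moreover have "(\<integral>t. (g t - A u t) / (\<alpha> * A u t) * (A v t - A u t) \<partial>N) = - G / \<alpha>"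
  proof -
    have "(\<integral>t. (g t - A u t) / (\<alpha> * A u t) * (A v t - A u t) \<partial>N)
        = (\<integral>t. (- 1 / \<alpha>) * ((1 - g t / z t) * h t) \<partial>N)"
    proof (rule integral_cong_AE)
      show "AE t in N. (g t - A u t) / (\<alpha> * A u t) * (A v t - A u t)
          = (- 1 / \<alpha>) * ((1 - g t / z t) * h t)"
        using z(2) by eventually_elim (use \<open>0 < c\<close> \<open>0 < \<alpha>\<close> in \<open>simp add: z_def h_def field_simps\<close>)
    qed (simp_all add: z_def h_def)
    thus ?thesis by (simp add: G_def)
  qed
  ultimately show ?thesis by (simp add: ru rv)
qed simp


section \<open>Conjugates and Bregman distances\<close>

text \<open>A subgradient turns the Fenchel-Young inequality into an equality: the supremum is attained.\<close>

lemma fenchel_conj_at_subgradient: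
  assumes "u \<in> L1 M" "R u = ereal r" "\<And>v. v \<in> L1 M \<Longrightarrow> R u + ereal (\<xi> v - \<xi> u) \<le> R v"
  shows "fenchel_conj_L1 M R \<xi> = ereal (\<xi> u - r)"
  unfolding fenchel_conj_L1_def
proof (rule antisym)
  show "(SUP v \<in> L1 M. ereal (\<xi> v) - R v) \<le> ereal (\<xi> u - r)"
  proof (rule SUP_least)
    fix v assume "v \<in> L1 M"
    from assms(3)[OF this] show "ereal (\<xi> v) - R v \<le> ereal (\<xi> u - r)"
      by (cases "R v") (auto simp: assms(2))
  qed
  have "ereal (\<xi> u) - R u \<le> (SUP v \<in> L1 M. ereal (\<xi> v) - R v)"
    using assms(1) by (rule SUP_upper)
  thus "ereal (\<xi> u - r) \<le> (SUP v \<in> L1 M. ereal (\<xi> v) - R v)" by (simp add: assms(2))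
qed

text \<open>With \<open>p\<close> and \<open>q\<close> dual certificates at \<open>u\<close> and \<open>w\<close>, the conjugates turn the dual distance into
  the reversed primal one, \<open>R w - R u - \<langle>p, A (w - u)\<rangle>\<close>. Adding the two distances cancels all values of
  \<open>R\<close> and leaves \<open>\<langle>p - q, A u - A w\<rangle>\<close>.\<close>

lemma bregman_sum_identity:
  fixes A :: "('a \<Rightarrow> real) \<Rightarrow> 'b \<Rightarrow> real"
  assumes "finite_measure N" "linear_L1_Linf M N A" "p \<in> Linf N" "q \<in> Linf N"
    and u: "u \<in> L1 M" "R u = ereal ru" and w: "w \<in> L1 M" "R w = ereal rw"
    and p: "\<And>v. v \<in> L1 M \<Longrightarrow> R u + ereal (\<integral>t. p t * (A v t - A u t) \<partial>N) \<le> R v"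
    and q: "\<And>v. v \<in> L1 M \<Longrightarrow> R w + ereal (\<integral>t. q t * (A v t - A w t) \<partial>N) \<le> R v"
  obtains D D' where
    "bregman R (adjoint_op A (pairing N q)) u w = ereal D"
    "bregman_dual (fenchel_conj_L1 M R) w (adjoint_op A (pairing N p)) (adjoint_op A (pairing N q))
      = ereal D'"
    "0 \<le> D'" "D + D' = (\<integral>t. (p t - q t) * (A u t - A w t) \<partial>N)"
proof -
  interpret finite_measure N by fact
  note A_Linf = linear_op_Linf[OF assms(2)]
  define P where "P = (\<lambda>v. \<integral>t. p t * A v t \<partial>N)"
  define Q where "Q = (\<lambda>v. \<integral>t. q t * A v t \<partial>N)"
  have adj: "adjoint_op A (pairing N p) = P" "adjoint_op A (pairing N q) = Q"
    by (auto simp: adjoint_op_def pairing_def P_def Q_def)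
  have int: "integrable N (\<lambda>t. y t * A v t)" if "y \<in> Linf N" "v \<in> L1 M" for y v
    using that by (intro Linf_integrable Linf_mult A_Linf)
  have diff: "(\<integral>t. y t * (A v t - A v' t) \<partial>N) = (\<integral>t. y t * A v t \<partial>N) - (\<integral>t. y t * A v' t \<partial>N)"
    if "y \<in> Linf N" "v \<in> L1 M" "v' \<in> L1 M" for y v v'
    using int[of y v] int[of y v'] that by (simp add: right_diff_distrib)
  have conj_p: "fenchel_conj_L1 M R P = ereal (P u - ru)"
    using p diff[OF \<open>p \<in> Linf N\<close> _ u(1)] u by (intro fenchel_conj_at_subgradient) (auto simp: P_def)
  have conj_q: "fenchel_conj_L1 M R Q = ereal (Q w - rw)"
    using q diff[OF \<open>q \<in> Linf N\<close> _ w(1)] w by (intro fenchel_conj_at_subgradient) (auto simp: Q_def)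
  have meas: "A v \<in> borel_measurable N" if "v \<in> L1 M" for v
    using A_Linf[OF that] by (rule Linf_measurable)
  have [measurable]: "q \<in> borel_measurable N" using \<open>q \<in> Linf N\<close> by (rule Linf_measurable)
  have uw: "(\<lambda>x. u x - w x) \<in> L1 M" using L1_lincomb[OF u(1) w(1), of 1 "-1"] by simp
  note [measurable] = meas[OF u(1)] meas[OF w(1)] meas[OF uw]
  have "Q (\<lambda>x. u x - w x) = (\<integral>t. q t * (A u t - A w t) \<partial>N)"
    unfolding Q_def
    by (rule integral_cong_AE) (use linear_op_diff_AE[OF assms(2) u(1) w(1)] in \<open>auto\<close>)
  hence Q_uw: "Q (\<lambda>x. u x - w x) = Q u - Q w"
    using diff[OF \<open>q \<in> Linf N\<close> u(1) w(1)] by (simp add: Q_def)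
  show ?thesis
  proof (rule that)
    show "bregman R (adjoint_op A (pairing N q)) u w = ereal (ru - rw - (Q u - Q w))"
      by (simp add: bregman_def adj u w Q_uw)
    show "bregman_dual (fenchel_conj_L1 M R) w (adjoint_op A (pairing N p)) (adjoint_op A (pairing N q))
        = ereal (P u - ru - (Q w - rw) - (P w - Q w))"
      by (simp add: bregman_dual_def adj conj_p conj_q)
    show "0 \<le> P u - ru - (Q w - rw) - (P w - Q w)"
      using p[OF w(1)] diff[OF \<open>p \<in> Linf N\<close> w(1) u(1)] by (simp add: u w P_def)
    have "(\<integral>t. (p t - q t) * (A u t - A w t) \<partial>N)
        = (\<integral>t. p t * (A u t - A w t) - q t * (A u t - A w t) \<partial>N)"
      by (simp add: left_diff_distrib)
    also have "\<dots> = (\<integral>t. p t * (A u t - A w t) \<partial>N) - (\<integral>t. q t * (A u t - A w t) \<partial>N)"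
      using assms u w by (intro Bochner_Integration.integral_diff Linf_integrable Linf_mult Linf_diff A_Linf)
    also have "\<dots> = P u - P w - (Q u - Q w)"
      using diff u w \<open>p \<in> Linf N\<close> \<open>q \<in> Linf N\<close> by (simp add: P_def Q_def)
    finally show "ru - rw - (Q u - Q w) + (P u - ru - (Q w - rw) - (P w - Q w))
        = (\<integral>t. (p t - q t) * (A u t - A w t) \<partial>N)" by simp
  qed
qed


section \<open>Index functions\<close>

lemma inverse_ext_image:
  assumes "strict_mono_on {0..} \<Phi>" "0 \<le> d"
  shows "inverse_ext \<Phi> (\<Phi> d) = ereal d"
  using assms by (simp add: inverse_ext_def inv_into_f_f strict_mono_on_imp_inj_on)

lemma inverse_ext_nonneg: "0 \<le> inverse_ext \<Phi> t"
proof (cases "t \<in> \<Phi> ` {0..}")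
  case True
  hence "inv_into {0..} \<Phi> t \<in> {0..}" by (rule inv_into_into)
  thus ?thesis by (simp add: inverse_ext_def)
qed (simp add: inverse_ext_def)

lemma inverse_ext_mono:
  assumes "strict_mono_on {0..} \<Phi>" "continuous_on {0..} \<Phi>" "\<Phi> 0 = 0" "0 \<le> s" "s \<le> t"
  shows "inverse_ext \<Phi> s \<le> inverse_ext \<Phi> t"
proof (cases "t \<in> \<Phi> ` {0..}")
  case True
  then obtain b where b: "0 \<le> b" "t = \<Phi> b" by auto
  have "\<exists>a\<ge>0. a \<le> b \<and> \<Phi> a = s"
    using assms b by (intro IVT') (auto intro: continuous_on_subset)
  then obtain a where "0 \<le> a" "a \<le> b" "\<Phi> a = s" by auto
  thus ?thesis using inverse_ext_image[OF assms(1)] b by auto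
qed (simp add: inverse_ext_def)

lemma inverse_conj_young:
  assumes "0 \<le> t" shows "ereal (\<alpha> * t) \<le> inverse_conj \<Phi> \<alpha> + inverse_ext \<Phi> t"
proof -
  have "ereal (\<alpha> * t) - inverse_ext \<Phi> t \<le> inverse_conj \<Phi> \<alpha>"
    unfolding inverse_conj_def using assms by (intro SUP_upper) auto
  thus ?thesis using inverse_ext_nonneg[of \<Phi> t]
    by (cases "inverse_ext \<Phi> t"; cases "inverse_conj \<Phi> \<alpha>") auto
qed


section \<open>The convergence rate\<close>

text \<open>On a point of the domain, let \<open>z\<close> be the value of the reconstructed data, \<open>g\<close> and \<open>f\<close> the noisy
  and exact data, \<open>p\<close> and \<open>q\<close> the dual certificates. The definition of \<open>p\<close> says \<open>z (1 + \<alpha> p) = g\<close>, so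
  \<open>(1 + \<alpha> q) z = g + \<alpha> z a\<close> with \<open>a = q - p\<close>. Multiplying \<open>(p - q) (z - f) - \<alpha> f q (q - p)\<close> by
  \<open>1 + \<alpha> q\<close> therefore gives exactly \<open>- a (b + \<alpha> z a)\<close> with \<open>b = g - f + \<alpha>\<^sup>2 f q\<^sup>2\<close>, whose maximum over
  \<open>a\<close> is \<open>b\<^sup>2 / (4 \<alpha> z)\<close>. The factor 3 lost in dividing by \<open>1 + \<alpha> q \<ge> 1/3\<close>, together with
  \<open>b\<^sup>2 \<le> 2 (g - f)\<^sup>2 + 2 (\<alpha>\<^sup>2 f q\<^sup>2)\<^sup>2\<close>, produces the constant \<open>2 m / 3\<close>.\<close>

lemma source_term_pointwise_le:
  fixes \<alpha> \<delta> f g m p q z :: real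
  assumes "0 < \<alpha>" "0 < m" "m \<le> z" "\<bar>f - g\<bar> \<le> \<delta>" "\<alpha> * \<bar>q\<bar> \<le> 2 / 3"
    and p: "p = (g - z) / (\<alpha> * z)"
  shows "(p - q) * (z - f)
    \<le> \<alpha> * (f * q * (q - p)) + (\<delta>\<^sup>2 + \<alpha> ^ 4 * (f * q\<^sup>2)\<^sup>2) / (\<alpha> * (2 * m / 3))"
proof -
  define a where "a = q - p"
  define b where "b = g - f + \<alpha>\<^sup>2 * (f * q\<^sup>2)"
  define k where "k = 1 + \<alpha> * q"
  define X where "X = \<delta>\<^sup>2 + \<alpha> ^ 4 * (f * q\<^sup>2)\<^sup>2"
  have z: "0 < z" using assms by simp
  have "\<bar>\<alpha> * q\<bar> \<le> 2 / 3" using assms by (simp add: abs_mult)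
  hence k: "1 / 3 \<le> k" by (simp add: k_def abs_le_iff)
  have "z * (1 + \<alpha> * p) = g" using z \<open>0 < \<alpha>\<close> by (simp add: p field_simps)
  hence zk: "z * k = g + \<alpha> * z * a" by (simp add: k_def a_def algebra_simps)
  have "k * ((p - q) * (z - f) - \<alpha> * (f * q * (q - p))) = - a * (z * k - k * f + \<alpha> * f * q * k)"
    by (simp add: a_def algebra_simps)
  also have "\<dots> = - a * (b + \<alpha> * z * a)"
    unfolding zk by (simp add: b_def k_def power2_eq_square algebra_simps)
  also have "\<dots> \<le> b\<^sup>2 / (4 * \<alpha> * z)"
  proof -
    have "0 \<le> (2 * \<alpha> * z * a + b)\<^sup>2 / (4 * \<alpha> * z)" using z \<open>0 < \<alpha>\<close> by simp
    also have "\<dots> = a * (b + \<alpha> * z * a) + b\<^sup>2 / (4 * \<alpha> * z)"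
      using z \<open>0 < \<alpha>\<close> by (simp add: power2_eq_square field_simps)
    finally show ?thesis by simp
  qed
  also have "\<dots> \<le> 2 * X / (4 * \<alpha> * m)"
  proof (rule frac_le)
    have "(g - f)\<^sup>2 \<le> \<delta>\<^sup>2" using assms by (intro abs_le_square_iff[THEN iffD1]) linarith
    moreover have "b\<^sup>2 \<le> 2 * (g - f)\<^sup>2 + 2 * (\<alpha>\<^sup>2 * (f * q\<^sup>2))\<^sup>2"
      using sum_squares_bound[of "g - f" "\<alpha>\<^sup>2 * (f * q\<^sup>2)"]
      by (simp add: b_def power2_sum)
    ultimately show "b\<^sup>2 \<le> 2 * X" by (simp add: X_def power_mult_distrib flip: power_mult)
  qed (use assms z in \<open>auto simp: X_def\<close>)
  finally have main: "k * ((p - q) * (z - f) - \<alpha> * (f * q * (q - p))) \<le> 2 * X / (4 * \<alpha> * m)" .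
  have X: "0 \<le> X" by (simp add: X_def)
  have "(p - q) * (z - f) - \<alpha> * (f * q * (q - p)) \<le> 2 * X / (4 * \<alpha> * m) / k"
    by (rule mult_imp_le_div_pos) (use k in simp, subst mult.commute, rule main)
  also have "\<dots> \<le> 2 * X / (4 * \<alpha> * m) / (1 / 3)"
    using k X assms by (intro divide_left_mono) auto
  also have "\<dots> = X / (\<alpha> * (2 * m / 3))" by simp
  finally show ?thesis by (simp add: X_def)
qed

lemma minimizer_finite:
  assumes min: "is_arg_min (\<lambda>v. ereal (1 / \<alpha>) * KL N g (A v) + R v) (\<lambda>v. v \<in> L1 M) u"
    and "0 < \<alpha>" "v \<in> L1 M" "KL N g (A v) < \<infinity>" "R v < \<infinity>"
  shows "R u < \<infinity>"
proof (rule ccontr)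
  assume "\<not> R u < \<infinity>"
  hence "ereal (1 / \<alpha>) * KL N g (A u) + R u = \<infinity>"
    using \<open>0 < \<alpha>\<close> KL_nonneg[of N g "A u"] by simp
  moreover have "ereal (1 / \<alpha>) * KL N g (A v) + R v < \<infinity>"
    using assms KL_nonneg[of N g "A v"] by (cases "KL N g (A v)"; cases "R v") auto
  ultimately show False using min \<open>v \<in> L1 M\<close> unfolding is_arg_min_def by auto
qed

text \<open>The estimate for one pair of parameters. The sum \<open>D + D'\<close> of the primal and the dual distance is
  bounded by the pointwise estimate; its term \<open>\<alpha> \<integral> f q (q - p)\<close> is at most \<open>\<alpha> \<Phi>(D')\<close> by the source
  condition, hence at most \<open>\<Psi>(\<alpha>) + D'\<close>. So the dual distance cancels. The last term of the pointwise
  estimate is \<open>\<alpha>\<close> times a quantity of order \<open>\<alpha>\<^sup>2\<close>, and Young's inequality trades it for another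
  \<open>\<Psi>(\<alpha>)\<close> and a value of \<open>\<Phi>\<inverse>\<close>.\<close>

lemma bregman_rate:
  fixes A :: "('a \<Rightarrow> real) \<Rightarrow> 'b \<Rightarrow> real" and \<alpha> \<delta> m :: real
  assumes "finite_measure N" "linear_L1_Linf M N A" "functional_L1 M R" "convex_L1 M R"
    and \<alpha>: "0 < \<alpha>" and g: "g \<in> Linf N" "AE t in N. 0 < g t"
    and min: "is_arg_min (\<lambda>v. ereal (1 / \<alpha>) * KL N g (A v) + R v) (\<lambda>v. v \<in> L1 M) u"
    and "R u < \<infinity>" and m: "0 < m" "AE t in N. m \<le> A u t"
    and f: "f \<in> Linf N" "AE t in N. \<bar>f t - g t\<bar> \<le> \<delta>"
    and w: "w \<in> L1 M" "ae_eq N (A w) f"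
    and q: "q \<in> Linf N" "AE t in N. \<alpha> * \<bar>q t\<bar> \<le> 2 / 3"
      "adjoint_op A (pairing N q) \<in> subdifferential_L1 M R w"
    and \<Phi>: "strict_mono_on {0..} \<Phi>" "\<Phi> \<in> {0..} \<rightarrow> {0..}"
    and source: "\<And>p. p \<in> Linf N \<Longrightarrow> ereal (\<integral>t. f t * q t * (q t - p t) \<partial>N)
        \<le> ext_infty \<Phi> (bregman_dual (fenchel_conj_L1 M R) w
             (adjoint_op A (pairing N p)) (adjoint_op A (pairing N q)))"
    and \<gamma>: "\<gamma> = 2 * m / 3"
  shows "bregman R (adjoint_op A (pairing N q)) u w
    \<le> ereal (\<delta>\<^sup>2 / \<alpha> * (measure N (space N) / \<gamma>)) + 2 * inverse_conj \<Phi> \<alpha>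
       + inverse_ext \<Phi> (\<alpha>\<^sup>2 * (L2_norm N (\<lambda>t. f t * (q t)\<^sup>2))\<^sup>2 / \<gamma>)"
proof -
  interpret finite_measure N by fact
  have u: "u \<in> L1 M" using min by (simp add: is_arg_min_def)
  note A_Linf = linear_op_Linf[OF assms(2)]
  obtain ru where ru: "R u = ereal ru"
    using \<open>R u < \<infinity>\<close> \<open>functional_L1 M R\<close> u unfolding functional_L1_def by (cases "R u") auto
  have "R w < \<infinity>" using q(3) by (simp add: subdifferential_L1_def)
  then obtain rw where rw: "R w = ereal rw"
    using \<open>functional_L1 M R\<close> w unfolding functional_L1_def by (cases "R w") auto
  have meas: "A v \<in> borel_measurable N" if "v \<in> L1 M" for v
    using A_Linf[OF that] by (rule Linf_measurable)
  note [measurable] = meas[OF u] meas[OF w(1)] Linf_measurable[OF g(1)] Linf_measurable[OF f(1)]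
    Linf_measurable[OF q(1)]

  define p where "p = (\<lambda>t. (g t - A u t) / (\<alpha> * A u t))"
  have p: "p \<in> Linf N"
  proof -
    have "AE t in N. \<alpha> * m \<le> \<alpha> * A u t" using m(2) by eventually_elim (use \<alpha> in simp)
    thus ?thesis unfolding p_def
      using \<alpha> m(1) by (intro Linf_divide[where c = "\<alpha> * m"] Linf_diff g A_Linf u) auto
  qed
  note [measurable] = Linf_measurable[OF p]
  have p_sub: "R u + ereal (\<integral>t. p t * (A v t - A u t) \<partial>N) \<le> R v" if "v \<in> L1 M" for v
    unfolding p_def using assms that by (intro minimizer_subgradient[where c = m])
  have q_sub: "R w + ereal (\<integral>t. q t * (A v t - A w t) \<partial>N) \<le> R v" if v: "v \<in> L1 M" for v
  proof -
    have vw: "(\<lambda>x. v x - w x) \<in> L1 M" using L1_lincomb[OF v w(1), of 1 "-1"] by simp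
    note [measurable] = meas[OF v] meas[OF vw]
    have "(\<integral>t. q t * A (\<lambda>x. v x - w x) t \<partial>N) = (\<integral>t. q t * (A v t - A w t) \<partial>N)"
      by (rule integral_cong_AE) (use linear_op_diff_AE[OF assms(2) v w(1)] in auto)
    thus ?thesis
      using q(3) v by (auto simp: subdifferential_L1_def adjoint_op_def pairing_def)
  qed
  obtain D D' where D: "bregman R (adjoint_op A (pairing N q)) u w = ereal D"
    and D': "bregman_dual (fenchel_conj_L1 M R) w (adjoint_op A (pairing N p))
        (adjoint_op A (pairing N q)) = ereal D'" "0 \<le> D'"
    and sum: "D + D' = (\<integral>t. (p t - q t) * (A u t - A w t) \<partial>N)"
    using bregman_sum_identity[OF assms(1,2) p q(1) u ru w(1) rw p_sub q_sub] by metis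

  define S where "S = (\<integral>t. f t * q t * (q t - p t) \<partial>N)"
  define T where "T = (\<integral>t. (f t * (q t)\<^sup>2)\<^sup>2 \<partial>N)"
  define bound where "bound = (\<lambda>t. \<alpha> * (f t * q t * (q t - p t))
      + (\<delta>\<^sup>2 + \<alpha> ^ 4 * (f t * (q t)\<^sup>2)\<^sup>2) * (1 / (\<alpha> * \<gamma>)))"
  have int_S: "integrable N (\<lambda>t. f t * q t * (q t - p t))"
    by (intro Linf_integrable Linf_intros f q p)
  have int_T: "integrable N (\<lambda>t. (f t * (q t)\<^sup>2)\<^sup>2)"
    by (intro Linf_integrable Linf_intros f q p)
  have "D + D' \<le> (\<integral>t. bound t \<partial>N)"
    unfolding sum
  proof (rule integral_mono_AE)
    show "integrable N (\<lambda>t. (p t - q t) * (A u t - A w t))"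
      by (intro Linf_integrable Linf_mult Linf_diff p q A_Linf u w)
    show "integrable N bound"
      unfolding bound_def by (intro Linf_integrable Linf_intros f q p)
    show "AE t in N. (p t - q t) * (A u t - A w t) \<le> bound t"
      using m(2) f(2) q(2) w(2)[unfolded ae_eq_def]
    proof eventually_elim
      case (elim t)
      show ?case
        using source_term_pointwise_le[OF \<alpha> m(1) elim(1-3), of "p t"] elim(4)
        by (simp add: bound_def p_def \<gamma>)
    qed
  qed
  also have "(\<integral>t. bound t \<partial>N) = \<alpha> * S + (\<delta>\<^sup>2 * measure N (space N) + \<alpha> ^ 4 * T) * (1 / (\<alpha> * \<gamma>))"
    unfolding bound_def S_def T_def using int_S int_T by simp
  also have "\<dots> = \<alpha> * S + \<delta>\<^sup>2 / \<alpha> * (measure N (space N) / \<gamma>) + \<alpha> * (\<alpha>\<^sup>2 * T / \<gamma>)"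
    using \<alpha> m(1) by (simp add: \<gamma> field_simps power4_eq_xxxx power2_eq_square)
  finally have D_le: "D + D' \<le> \<alpha> * S + \<delta>\<^sup>2 / \<alpha> * (measure N (space N) / \<gamma>) + \<alpha> * (\<alpha>\<^sup>2 * T / \<gamma>)" .

  have "S \<le> \<Phi> D'" using source[OF p] by (simp add: S_def D' ext_infty_def)
  hence "\<alpha> * S \<le> \<alpha> * \<Phi> D'" using \<alpha> by simp
  with D_le have D_le': "D + D' \<le> \<alpha> * \<Phi> D' + \<delta>\<^sup>2 / \<alpha> * (measure N (space N) / \<gamma>) + \<alpha> * (\<alpha>\<^sup>2 * T / \<gamma>)"
    by linarith
  have young1: "ereal (\<alpha> * \<Phi> D') \<le> inverse_conj \<Phi> \<alpha> + ereal D'"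
    using inverse_conj_young[of "\<Phi> D'" \<alpha> \<Phi>] inverse_ext_image[OF \<Phi>(1) D'(2)] \<Phi>(2) D'(2) by auto
  have T: "0 \<le> T" by (simp add: T_def)
  hence "0 \<le> \<alpha>\<^sup>2 * T / \<gamma>" using m(1) by (simp add: \<gamma>)
  note young2 = inverse_conj_young[OF this, of \<alpha> \<Phi>]
  have "(L2_norm N (\<lambda>t. f t * (q t)\<^sup>2))\<^sup>2 = T" using T by (simp add: L2_norm_def T_def)
  moreover have "ereal D \<le> ereal (\<delta>\<^sup>2 / \<alpha> * (measure N (space N) / \<gamma>)) + 2 * inverse_conj \<Phi> \<alpha>
      + inverse_ext \<Phi> (\<alpha>\<^sup>2 * T / \<gamma>)"
    using D_le' young1 young2 inverse_ext_nonneg[of \<Phi> "\<alpha>\<^sup>2 * T / \<gamma>"]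
    by (cases "inverse_conj \<Phi> \<alpha>"; cases "inverse_ext \<Phi> (\<alpha>\<^sup>2 * T / \<gamma>)") auto
  ultimately show ?thesis by (simp add: D)
qed

theorem theorem5p5:
  fixes \<Omega> \<Gamma> :: "(real ^ 2) set"
    and A :: "(real ^ 2 \<Rightarrow> real) \<Rightarrow> real ^ 2 \<Rightarrow> real"
    and f :: "real ^ 2 \<Rightarrow> real"
    and f\<delta> :: "real \<Rightarrow> real ^ 2 \<Rightarrow> real"
    and R :: "(real ^ 2 \<Rightarrow> real) \<Rightarrow> ereal"
    and ud :: "real ^ 2 \<Rightarrow> real"
    and u :: "real \<Rightarrow> real \<Rightarrow> real ^ 2 \<Rightarrow> real"
    and pd :: "real ^ 2 \<Rightarrow> real"
    and \<Phi> :: "real \<Rightarrow> real"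
    and C1 C2 m \<gamma> :: real
  defines "M \<equiv> lebesgue_on \<Omega>" and "N \<equiv> lebesgue_on \<Gamma>"
  assumes "bounded \<Omega>" "\<Omega> \<in> sets lebesgue" "bounded \<Gamma>" "\<Gamma> \<in> sets lebesgue"
    and "linear_L1_Linf M N A" "compact_L1_Linf M N A" "\<not> well_posed M N A"
    and "f \<in> Linf N"
    and "\<And>\<delta>. \<delta> > 0 \<Longrightarrow> f\<delta> \<delta> \<in> Linf N"
    and "\<And>\<delta>. \<delta> > 0 \<Longrightarrow> AE t in N. 0 \<le> f\<delta> \<delta> t"
    and "\<And>\<delta>. \<delta> > 0 \<Longrightarrow> Linf_norm N (\<lambda>t. f t - f\<delta> \<delta> t) \<le> \<delta>"
    and "C1 > 0" "C2 > 0"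
    and "\<And>\<delta>. \<delta> > 0 \<Longrightarrow> AE t in N. C1 < f\<delta> \<delta> t \<and> f\<delta> \<delta> t < C2"
    and "functional_L1 M R" "proper_L1 M R" "convex_L1 M R" "lsc_L1 M R"
    and "is_arg_min R (\<lambda>v. v \<in> L1 M \<and> ae_eq N (A v) f) ud"
    and "\<And>\<alpha> \<delta>. \<alpha> > 0 \<Longrightarrow> \<delta> > 0 \<Longrightarrow>
           is_arg_min (\<lambda>v. ereal (1 / \<alpha>) * KL N (f\<delta> \<delta>) (A v) + R v) (\<lambda>v. v \<in> L1 M) (u \<alpha> \<delta>)"
    and "\<And>\<delta>. \<delta> > 0 \<Longrightarrow>
           \<exists>u0 \<in> L1 M. KL N (f\<delta> \<delta>) (A u0) < \<infinity> \<and> R u0 < \<infinity> \<and>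
             continuous_at_Linf N (KL N (f\<delta> \<delta>)) (A u0)"
    and "\<And>\<alpha> \<delta>. \<alpha> > 0 \<Longrightarrow> \<delta> > 0 \<Longrightarrow> A (u \<alpha> \<delta>) \<in> pos_bounded N"
    and "m > 0"
    and "\<exists>\<epsilon>>0. ereal m \<le> (INF (\<alpha>, \<delta>) \<in> {0<..<\<epsilon>} \<times> {0<..<\<epsilon>}. ess_inf N (A (u \<alpha> \<delta>)))"
    and "pd \<in> Linf N"
    and "adjoint_op A (pairing N pd) \<in> subdifferential_L1 M R ud"
    and "\<Phi> \<in> {0..} \<rightarrow> {0..}" "strict_mono_on {0..} \<Phi>" "continuous_on {0..} \<Phi>"
      "concave_on {0..} \<Phi>" "\<Phi> 0 = 0"
    and "\<And>p. p \<in> Linf N \<Longrightarrow>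
           ereal (\<integral>t. f t * pd t * (pd t - p t) \<partial>N)
             \<le> ext_infty \<Phi> (bregman_dual (fenchel_conj_L1 M R) ud
                  (adjoint_op A (pairing N p)) (adjoint_op A (pairing N pd)))"
    and "\<gamma> = 2 * m / 3"
  shows "\<exists>\<epsilon>>0. \<forall>\<alpha> \<delta>. 0 < \<alpha> \<and> \<alpha> < \<epsilon> \<and> 0 < \<delta> \<and> \<delta> < \<epsilon> \<longrightarrow>
           bregman R (adjoint_op A (pairing N pd)) (u \<alpha> \<delta>) ud
             \<le> ereal (\<delta>\<^sup>2 / \<alpha> * (measure lebesgue \<Gamma> / \<gamma>))
                + 2 * inverse_conj \<Phi> \<alpha>
                + inverse_ext \<Phi>
                    (\<delta>\<^sup>2 * (L2_norm N pd)\<^sup>2 / \<gamma>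
                     + \<alpha>\<^sup>2 * \<delta>\<^sup>2 * (L2_norm N (\<lambda>t. (pd t)\<^sup>2))\<^sup>2 / \<gamma>
                     + \<alpha>\<^sup>2 * (L2_norm N (\<lambda>t. f t * (pd t)\<^sup>2))\<^sup>2 / \<gamma>)"
proof -
  have "\<Gamma> \<in> lmeasurable" using assms by (intro bounded_set_imp_lmeasurable)
  hence fin: "finite_measure N" unfolding N_def by (rule finite_measure_lebesgue_on)
  have space: "measure N (space N) = measure lebesgue \<Gamma>"
    using \<open>\<Gamma> \<in> sets lebesgue\<close> by (simp add: N_def measure_restrict_space)
  obtain \<epsilon>0 where \<epsilon>0: "0 < \<epsilon>0"
    "ereal m \<le> (INF (\<alpha>, \<delta>) \<in> {0<..<\<epsilon>0} \<times> {0<..<\<epsilon>0}. ess_inf N (A (u \<alpha> \<delta>)))"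
    using assms by blast
  obtain B where B: "0 \<le> B" "AE t in N. \<bar>pd t\<bar> \<le> B"
    using Linf_bound[OF \<open>pd \<in> Linf N\<close>] by auto
  have ud: "ud \<in> L1 M" "ae_eq N (A ud) f"
    using \<open>is_arg_min R _ ud\<close> by (auto simp: is_arg_min_def)
  \<comment> \<open>The second bound on the parameters makes \<open>1 + \<alpha> pd\<close> at least \<open>1/3\<close>.\<close>
  define \<epsilon> where "\<epsilon> = min \<epsilon>0 (2 / (3 * (B + 1)))"
  show ?thesis
  proof (intro exI[of _ \<epsilon>] conjI allI impI)
    show "0 < \<epsilon>" using \<epsilon>0(1) B(1) by (simp add: \<epsilon>_def)
    fix \<alpha> \<delta> :: real
    assume small: "0 < \<alpha> \<and> \<alpha> < \<epsilon> \<and> 0 < \<delta> \<and> \<delta> < \<epsilon>"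
    hence \<alpha>: "0 < \<alpha>" and \<delta>: "0 < \<delta>" by auto
    have "(INF (\<alpha>, \<delta>) \<in> {0<..<\<epsilon>0} \<times> {0<..<\<epsilon>0}. ess_inf N (A (u \<alpha> \<delta>))) \<le> ess_inf N (A (u \<alpha> \<delta>))"
      using small by (intro INF_lower2[of "(\<alpha>, \<delta>)"]) (auto simp: \<epsilon>_def)
    with \<epsilon>0(2) have lower: "AE t in N. m \<le> A (u \<alpha> \<delta>) t"
      by (intro AE_ge_of_ess_inf_ge) (rule order_trans)
    have "AE t in N. \<bar>f t - f\<delta> \<delta> t\<bar> \<le> Linf_norm N (\<lambda>t. f t - f\<delta> \<delta> t)"
      using assms \<delta> by (intro AE_le_Linf_norm Linf_diff)
    hence noise: "AE t in N. \<bar>f t - f\<delta> \<delta> t\<bar> \<le> \<delta>"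
      by eventually_elim (use assms(13)[OF \<delta>] in linarith)
    have pos: "AE t in N. 0 < f\<delta> \<delta> t"
      using assms(16)[OF \<delta>] by eventually_elim (use \<open>C1 > 0\<close> in auto)
    have pd_small: "AE t in N. \<alpha> * \<bar>pd t\<bar> \<le> 2 / 3"
      using B(2)
    proof eventually_elim
      case (elim t)
      have "\<alpha> * \<bar>pd t\<bar> \<le> 2 / (3 * (B + 1)) * (B + 1)"
        using small elim B(1) by (intro mult_mono) (auto simp: \<epsilon>_def)
      also have "\<dots> = 2 / 3" using B(1) by (simp add: field_simps)
      finally show ?case .
    qed
    have "R (u \<alpha> \<delta>) < \<infinity>" using assms(22)[OF \<alpha> \<delta>] assms(23)[OF \<delta>] \<alpha> minimizer_finite by blast
    have rate: "bregman R (adjoint_op A (pairing N pd)) (u \<alpha> \<delta>) ud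
      \<le> ereal (\<delta>\<^sup>2 / \<alpha> * (measure N (space N) / \<gamma>)) + 2 * inverse_conj \<Phi> \<alpha>
         + inverse_ext \<Phi> (\<alpha>\<^sup>2 * (L2_norm N (\<lambda>t. f t * (pd t)\<^sup>2))\<^sup>2 / \<gamma>)"
      by (rule bregman_rate[where g = "f\<delta> \<delta>" and m = m]) (fact | rule assms \<alpha> \<delta>)+
    also have "\<dots> \<le> ereal (\<delta>\<^sup>2 / \<alpha> * (measure lebesgue \<Gamma> / \<gamma>)) + 2 * inverse_conj \<Phi> \<alpha>
       + inverse_ext \<Phi>
           (\<delta>\<^sup>2 * (L2_norm N pd)\<^sup>2 / \<gamma>
            + \<alpha>\<^sup>2 * \<delta>\<^sup>2 * (L2_norm N (\<lambda>t. (pd t)\<^sup>2))\<^sup>2 / \<gamma>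
            + \<alpha>\<^sup>2 * (L2_norm N (\<lambda>t. f t * (pd t)\<^sup>2))\<^sup>2 / \<gamma>)"
    proof -
      have "0 < \<gamma>" using assms by simp
      thus ?thesis unfolding space
        by (intro add_left_mono inverse_ext_mono \<open>strict_mono_on {0..} \<Phi>\<close>
            \<open>continuous_on {0..} \<Phi>\<close> \<open>\<Phi> 0 = 0\<close>) auto
    qed
    finally show "bregman R (adjoint_op A (pairing N pd)) (u \<alpha> \<delta>) ud
             \<le> ereal (\<delta>\<^sup>2 / \<alpha> * (measure lebesgue \<Gamma> / \<gamma>))
                + 2 * inverse_conj \<Phi> \<alpha>
                + inverse_ext \<Phi>
                    (\<delta>\<^sup>2 * (L2_norm N pd)\<^sup>2 / \<gamma>
                     + \<alpha>\<^sup>2 * \<delta>\<^sup>2 * (L2_norm N (\<lambda>t. (pd t)\<^sup>2))\<^sup>2 / \<gamma>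
                     + \<alpha>\<^sup>2 * (L2_norm N (\<lambda>t. f t * (pd t)\<^sup>2))\<^sup>2 / \<gamma>)" .
  qed
qed

end
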